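(* Let $k\ge1$, $d\ge0$, and let $x^b$ be a monomial of degree $d$ in $\mathcal P_k$. The row of the hit matrix $M(k,d)$ indexed by $x^b$ is zero if and only if $x^b$ is a spike.
   Context: $\mathbb N$ includes $0$. $\mathcal P_k=\mathbb F_2[x_1,\dots,x_k]$ with $\deg x_i=1$; $\mathcal P_k^n$ is the degree-$n$ part. For $e\in\mathbb N^k$, $x^e=\prod x_i^{e_i}$, $|e|=\sum e_i$. Steenrod squares act linearly by $\mathrm{Sq}^r(x^a)=\sum_{b\in\mathbb N^k,|b|=r}\prod_i\binom{a_i}{b_i}x^{a+b}$ (mod 2). The hit matrix $M(k,d)$ is the matrix, in monomial bases, of $\bigoplus_{t\ge0,\,2^t\le d}\mathcal P_k^{d-2^t}\to\mathcal P_k^d$, $(g_t)_t\mapsto\sum_t\mathrm{Sq}^{2^t}(g_t)$; rows are indexed by degree-$d$ monomials and columns are labelled by pairs $(t,g)$ with $g$ a monomial of degree $d-2^t$. (For $d=0$ there is one row and no column; that row counts as zero.) A monomial $x^b$ is a spike if each $b_i=2^{m_i}-1$ for an integer $m_i\ge0$ (zero exponents allowed). *)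

theory Defs
  imports Complex_Main "HOL-Library.Poly_Mapping" "HOL-Library.Z2"
begin

text \<open>
  Variables are numbered from 0.  An exponent vector \<open>e \<in> \<nat>\<^sup>k\<close> is a finitely supported
  function with support in \<open>{..<k}\<close>, and a polynomial over \<open>\<F>\<^sub>2\<close> (the type \<^typ>\<open>bit\<close>) maps
  exponent vectors to coefficients, so that \<open>x\<^sup>e\<close> is \<open>Poly_Mapping.single e 1\<close>.
\<close>

type_synonym expvec = "nat \<Rightarrow>\<^sub>0 nat"
type_synonym f2poly = "expvec \<Rightarrow>\<^sub>0 bit"

definition expvecs :: "nat \<Rightarrow> nat \<Rightarrow> expvec set" where
  "expvecs k n = {e. Poly_Mapping.keys e \<subseteq> {..<k} \<and> (\<Sum>i<k. Poly_Mapping.lookup e i) = n}"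

definition xpow :: "expvec \<Rightarrow> f2poly" where
  "xpow e = Poly_Mapping.single e 1"

definition homog :: "nat \<Rightarrow> nat \<Rightarrow> f2poly set" where
  "homog k n = {f. Poly_Mapping.keys f \<subseteq> expvecs k n}"

text \<open>The Steenrod square on \<open>\<P>\<^sub>k\<close>, extended linearly from monomials.\<close>

definition Sq :: "nat \<Rightarrow> nat \<Rightarrow> f2poly \<Rightarrow> f2poly" where
  "Sq k r f = (\<Sum>a\<in>Poly_Mapping.keys f. \<Sum>b\<in>expvecs k r.
     Poly_Mapping.single (a + b)
       (Poly_Mapping.lookup f a * of_nat (\<Prod>i<k. Poly_Mapping.lookup a i choose Poly_Mapping.lookup b i)))"

text \<open>
  The direct sum of the spaces \<open>\<P>\<^sub>k\<^bsup>d-2^t\<^esup>\<close> over all \<open>t\<close> with \<open>2^t \<le> d\<close>, as finitely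
  supported families, and the map whose image is the space of hit polynomials of degree \<open>d\<close>.
\<close>

definition hit_dom :: "nat \<Rightarrow> nat \<Rightarrow> (nat \<Rightarrow>\<^sub>0 f2poly) set" where
  "hit_dom k d =
     {G. \<forall>t\<in>Poly_Mapping.keys G. 2 ^ t \<le> d \<and> Poly_Mapping.lookup G t \<in> homog k (d - 2 ^ t)}"

definition hit_map :: "nat \<Rightarrow> nat \<Rightarrow> (nat \<Rightarrow>\<^sub>0 f2poly) \<Rightarrow> f2poly" where
  "hit_map k d G = (\<Sum>t | 2 ^ t \<le> d. Sq k (2 ^ t) (Poly_Mapping.lookup G t))"

definition hit_columns :: "nat \<Rightarrow> nat \<Rightarrow> (nat \<times> expvec) set" where
  "hit_columns k d = {(t, g). 2 ^ t \<le> d \<and> g \<in> expvecs k (d - 2 ^ t)}"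

text \<open>
  The basis vector of the domain labelled \<open>(t, g)\<close> is the family with \<open>x\<^sup>g\<close> in component \<open>t\<close>
  and \<open>0\<close> elsewhere.  The matrix is the following function restricted to row indices in
  \<open>expvecs k d\<close> and column indices in \<open>hit_columns k d\<close>; for \<open>d = 0\<close> there are no columns.
\<close>

definition hit_basis :: "nat \<times> expvec \<Rightarrow> (nat \<Rightarrow>\<^sub>0 f2poly)" where
  "hit_basis c = Poly_Mapping.single (fst c) (xpow (snd c))"

definition hit_matrix :: "nat \<Rightarrow> nat \<Rightarrow> expvec \<Rightarrow> nat \<times> expvec \<Rightarrow> bit" where
  "hit_matrix k d b c = Poly_Mapping.lookup (hit_map k d (hit_basis c)) b"

definition zero_row :: "nat \<Rightarrow> nat \<Rightarrow> expvec \<Rightarrow> bool" where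
  "zero_row k d b \<longleftrightarrow> (\<forall>c\<in>hit_columns k d. hit_matrix k d b c = 0)"

definition spike :: "nat \<Rightarrow> expvec \<Rightarrow> bool" where
  "spike k b \<longleftrightarrow> (\<forall>i<k. \<exists>m. Poly_Mapping.lookup b i = 2 ^ m - 1)"

lemma finite_expvecs: "finite (expvecs k n)"
proof -
  have "Poly_Mapping.lookup ` expvecs k n \<subseteq> {f. \<forall>i. (i \<in> {..<k} \<longrightarrow> f i \<in> {..n}) \<and> (i \<notin> {..<k} \<longrightarrow> f i = 0)}"
    by (auto simp: expvecs_def in_keys_iff member_le_sum intro!: member_le_sum)
  moreover have "finite {f. \<forall>i. (i \<in> {..<k} \<longrightarrow> f i \<in> {..n}) \<and> (i \<notin> {..<k} \<longrightarrow> f i = (0::nat))}"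
    by (rule finite_set_of_finite_funs) auto
  ultimately have "finite (Poly_Mapping.lookup ` expvecs k n)"
    by (rule finite_subset)
  moreover have "inj_on (Poly_Mapping.lookup :: expvec \<Rightarrow> _) (expvecs k n)"
    by (auto intro!: inj_onI poly_mapping_eqI)
  ultimately show ?thesis
    by (rule finite_imageD)
qed

lemma Sq_eq_sum:
  assumes "finite A" "Poly_Mapping.keys f \<subseteq> A"
  shows "Sq k r f = (\<Sum>a\<in>A. \<Sum>b\<in>expvecs k r.
     Poly_Mapping.single (a + b)
       (Poly_Mapping.lookup f a * of_nat (\<Prod>i<k. Poly_Mapping.lookup a i choose Poly_Mapping.lookup b i)))"
  unfolding Sq_def by (rule sum.mono_neutral_left) (use assms in \<open>auto simp: in_keys_iff\<close>)

lemma Sq_zero [simp]: "Sq k r 0 = 0"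
  by (simp add: Sq_def)

lemma Sq_add: "Sq k r (f + g) = Sq k r f + Sq k r g"
proof -
  let ?A = "Poly_Mapping.keys f \<union> Poly_Mapping.keys g"
  have "Poly_Mapping.keys (f + g) \<subseteq> ?A" by (rule keys_add)
  then have "Sq k r (f + g) = (\<Sum>a\<in>?A. \<Sum>b\<in>expvecs k r.
      Poly_Mapping.single (a + b) (Poly_Mapping.lookup (f + g) a *
        of_nat (\<Prod>i<k. Poly_Mapping.lookup a i choose Poly_Mapping.lookup b i)))"
    by (intro Sq_eq_sum) auto
  then show ?thesis
    by (simp only: Sq_eq_sum[of ?A f] Sq_eq_sum[of ?A g] finite_UnI finite_keys Un_upper1 Un_upper2
        lookup_add distrib_right single_add sum.distrib)
qed

lemma Sq_xpow:
  "Sq k r (xpow a) = (\<Sum>b\<in>expvecs k r.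
     Poly_Mapping.single (a + b) (of_nat (\<Prod>i<k. Poly_Mapping.lookup a i choose Poly_Mapping.lookup b i)))"
proof -
  have "Poly_Mapping.keys (xpow a) = {a}" "Poly_Mapping.lookup (xpow a) a = 1"
    by (simp_all add: xpow_def)
  then show ?thesis
    by (simp only: Sq_def sum.insert finite.emptyI empty_iff sum.empty mult_1_left add_0_right
        not_False_eq_True)
qed

lemma expvecs_add: "a \<in> expvecs k m \<Longrightarrow> b \<in> expvecs k n \<Longrightarrow> a + b \<in> expvecs k (m + n)"
  using keys_add[of a b] by (auto simp: expvecs_def lookup_add sum.distrib)

lemma homog_sum: "(\<And>i. i \<in> I \<Longrightarrow> f i \<in> homog k n) \<Longrightarrow> sum f I \<in> homog k n"
  using keys_sum[of f I] by (force simp: homog_def)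

lemma Sq_homog: "f \<in> homog k n \<Longrightarrow> Sq k r f \<in> homog k (n + r)"
  unfolding Sq_def
  by (intro homog_sum) (auto simp: homog_def split: if_splits dest: expvecs_add)

lemma hit_map_homog: "G \<in> hit_dom k d \<Longrightarrow> hit_map k d G \<in> homog k d"
  unfolding hit_map_def
proof (intro homog_sum)
  fix t assume G: "G \<in> hit_dom k d" and t: "t \<in> {t. 2 ^ t \<le> d}"
  then have "Poly_Mapping.lookup G t \<in> homog k (d - 2 ^ t)"
    by (cases "t \<in> Poly_Mapping.keys G") (auto simp: hit_dom_def homog_def in_keys_iff)
  then show "Sq k (2 ^ t) (Poly_Mapping.lookup G t) \<in> homog k d"
    using Sq_homog[of _ k "d - 2 ^ t" "2 ^ t"] t by simp
qed

lemma hit_basis_in_hit_dom: "c \<in> hit_columns k d \<Longrightarrow> hit_basis c \<in> hit_dom k d"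
  by (auto simp: hit_columns_def hit_basis_def hit_dom_def homog_def xpow_def split: if_splits)

end

theory Submission imports Defs
begin

text \<open>
  The coefficient of \<open>x\<^sup>b\<close> in \<open>Sq\<^sup>r(x\<^sup>g)\<close> is \<open>\<Prod>\<^sub>i C(g\<^sub>i, b\<^sub>i - g\<^sub>i)\<close> mod 2, because the
  increment \<open>c = b - g\<close> is the only one that contributes.  Its factors are
  \<open>C(n - c\<^sub>i, c\<^sub>i)\<close> with \<open>n = b\<^sub>i\<close>, so the theorem reduces to a statement about one variable:
  for which \<open>n\<close> is some \<open>C(n - c, c)\<close> with \<open>c > 0\<close> odd, and can \<open>c\<close> then be a power of 2?

  If \<open>n = 2\<^sup>m - 1\<close>, subtracting \<open>c\<close> complements the binary digits of \<open>c\<close>, so \<open>n - c\<close> and \<open>c\<close>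
  have disjoint digits and \<open>C(n - c, c)\<close> is even unless \<open>c = 0\<close>
  (\<open>even_choose_complement\<close>).  The square \<open>Sq\<close> of degree \<open>2\<^sup>t > 0\<close> raises some
  exponent, hence every entry in the row of a spike vanishes.  If \<open>n\<close> is not of this form, take
  for \<open>2\<^sup>t\<close> the lowest place at which \<open>n\<close> has the digit 0.  Then \<open>n\<close> has a digit 1 higher up, and
  borrowing from it gives \<open>n - 2\<^sup>t\<close> the digit 1 at this place, so \<open>C(n - 2\<^sup>t, 2\<^sup>t)\<close> is odd
  (\<open>odd_choose_pow2\<close>).  Lowering only the offending exponent of \<open>b\<close> by this \<open>2\<^sup>t\<close> gives a
  column with a non-zero entry, since the other factors are \<open>C(b\<^sub>j, 0) = 1\<close>.

  Both facts on binomials follow by stripping the last binary digit, for which two cases of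
  Lucas' theorem modulo 2 suffice.
\<close>

lemma even_choose_even_odd: "even ((2 * n) choose (2 * j + 1) :: nat)"
proof (cases n)
  case (Suc q)
  have "(2 * j + 1) * ((2 * n) choose (2 * j + 1)) = 2 * n * ((2 * q + 1) choose (2 * j))"
    using Suc_times_binomial_eq[of "2 * q + 1" "2 * j"] Suc by (simp add: mult.commute)
  then have "even ((2 * j + 1) * ((2 * n) choose (2 * j + 1)))"
    by simp
  then show ?thesis by simp
qed simp

lemma even_choose_odd_even_iff: "even ((2 * n + 1) choose (2 * j) :: nat) \<longleftrightarrow> even (n choose j)"
proof (induction n arbitrary: j)
  case 0
  show ?case by (cases j) (auto simp: binomial_eq_0)
next
  case (Suc n)
  show ?case
  proof (cases j)
    case (Suc i)
    \<comment> \<open>Pascal's rule applied twice; the middle term occurs twice and disappears modulo 2.\<close>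
    have "(2 * Suc n + 1) choose (2 * j) =
      ((2 * n + 1) choose (2 * i)) + 2 * ((2 * n + 1) choose (2 * i + 1))
        + ((2 * n + 1) choose (2 * Suc i))"
      using Suc by simp
    then have "even ((2 * Suc n + 1) choose (2 * j)) \<longleftrightarrow>
        (even ((2 * n + 1) choose (2 * i)) \<longleftrightarrow> even ((2 * n + 1) choose (2 * Suc i)))"
      by (simp only: even_add dvd_triv_left simp_thms)
    also have "\<dots> \<longleftrightarrow> (even (n choose i) \<longleftrightarrow> even (n choose Suc i))"
      unfolding Suc.IH ..
    also have "\<dots> \<longleftrightarrow> even (Suc n choose j)"
      unfolding \<open>j = Suc i\<close> by simp
    finally show ?thesis .
  qed simp
qed

text \<open>
  For odd \<open>c\<close> the upper index is even, so the last digits already clash; for even \<open>c\<close> the last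
  digit can be dropped from both indices, which replaces \<open>m\<close> by \<open>m - 1\<close>.
\<close>

lemma even_choose_complement:
  "0 < c \<Longrightarrow> c \<le> 2 ^ m - 1 \<Longrightarrow> even ((2 ^ m - 1 - c) choose c :: nat)"
proof (induction m arbitrary: c)
  case (Suc m)
  show ?case
  proof (cases "even c")
    case True
    then obtain j where j: "c = 2 * j" by blast
    have eq: "2 ^ Suc m - 1 - c = 2 * (2 ^ m - 1 - j) + 1" and "0 < j" "j \<le> 2 ^ m - 1"
      using Suc.prems j by auto
    from \<open>0 < j\<close> \<open>j \<le> 2 ^ m - 1\<close> have "even ((2 ^ m - 1 - j) choose j)"
      by (rule Suc.IH)
    then show ?thesis
      unfolding eq[unfolded j] j even_choose_odd_even_iff .
  next
    case False
    then obtain j where j: "c = 2 * j + 1" by (auto elim: oddE)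
    have eq: "2 ^ Suc m - 1 - c = 2 * (2 ^ m - 1 - j)"
      using Suc.prems j by auto
    show ?thesis
      unfolding eq[unfolded j] j by (rule even_choose_even_odd)
  qed
qed simp

text \<open>
  The witness is the lowest zero digit of \<open>n\<close>: it is the last digit if \<open>n\<close> is even, where
  \<open>C(n - 1, 1) = n - 1\<close>, and otherwise comes from the number without its last digit 1.
\<close>

lemma odd_choose_pow2:
  fixes n :: nat
  assumes "\<nexists>m. n = 2 ^ m - 1"
  shows "\<exists>t. 2 ^ t \<le> n \<and> odd ((n - 2 ^ t) choose 2 ^ t)"
  using assms
proof (induction n rule: less_induct)
  case (less n)
  have "n \<noteq> 0"
    using less.prems by (metis diff_self_eq_0 power_0)
  show ?case
  proof (cases "even n")
    case True
    with \<open>n \<noteq> 0\<close> show ?thesis by (intro exI[of _ 0]) auto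
  next
    case False
    then obtain q where q: "n = 2 * q + 1" by (auto elim: oddE)
    have "\<nexists>m. q = 2 ^ m - 1"
    proof
      assume "\<exists>m. q = 2 ^ m - 1"
      then obtain m where "q = 2 ^ m - 1" by blast
      moreover have "(1::nat) \<le> 2 ^ m" by simp
      ultimately have "n = 2 ^ Suc m - 1" unfolding q power_Suc by linarith
      with less.prems show False by blast
    qed
    then obtain t where t: "2 ^ t \<le> q" "odd ((q - 2 ^ t) choose 2 ^ t)"
      using less.IH[of q] q by auto
    have "n - 2 ^ Suc t = 2 * (q - 2 ^ t) + 1" "2 ^ Suc t \<le> n"
      using t(1) q by auto
    then show ?thesis
      using t(2) even_choose_odd_even_iff[of "q - 2 ^ t" "2 ^ t"]
      by (intro exI[of _ "Suc t"]) simp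
  qed
qed

lemma of_nat_bit_eq_0_iff: "(of_nat n :: bit) = 0 \<longleftrightarrow> even n"
  by (induction n) auto

lemma hit_matrix_eq:
  assumes "(t, g) \<in> hit_columns k d"
  shows "hit_matrix k d b (t, g) =
    (\<Sum>c\<in>expvecs k (2 ^ t). if b = g + c
       then of_nat (\<Prod>i<k. Poly_Mapping.lookup g i choose Poly_Mapping.lookup c i) else 0)"
proof -
  have "{s. 2 ^ s \<le> d} \<subseteq> {..d}"
    by (auto intro: order.trans[OF less_imp_le[OF less_exp]])
  then have "finite {s. (2::nat) ^ s \<le> d}"
    using finite_subset by blast
  moreover have "Sq k (2 ^ s) (Poly_Mapping.lookup (hit_basis (t, g)) s) =
      (if s = t then Sq k (2 ^ t) (xpow g) else 0)" for s
    by (auto simp: hit_basis_def lookup_single)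
  ultimately have "hit_map k d (hit_basis (t, g)) = Sq k (2 ^ t) (xpow g)"
    using assms by (simp add: hit_map_def hit_columns_def)
  then show ?thesis
    by (auto simp: hit_matrix_def Sq_xpow lookup_sum lookup_single when_def intro!: sum.cong)
qed

lemma hit_matrix_eq_0_iff:
  assumes "(t, g) \<in> hit_columns k d"
  shows "hit_matrix k d b (t, g) = 0 \<longleftrightarrow>
    (\<forall>c\<in>expvecs k (2 ^ t). b = g + c \<longrightarrow>
      (\<exists>i<k. even (Poly_Mapping.lookup g i choose Poly_Mapping.lookup c i)))"
proof (cases "\<exists>c\<in>expvecs k (2 ^ t). b = g + c")
  case True
  then obtain c where c: "c \<in> expvecs k (2 ^ t)" "b = g + c" by blast
  then have "hit_matrix k d b (t, g) =
      of_nat (\<Prod>i<k. Poly_Mapping.lookup g i choose Poly_Mapping.lookup c i)"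
    unfolding hit_matrix_eq[OF assms] by (simp add: finite_expvecs)
  then show ?thesis
    using c by (auto simp: of_nat_bit_eq_0_iff even_prod_iff simp del: of_nat_prod)
next
  case False
  then show ?thesis
    unfolding hit_matrix_eq[OF assms] by (auto intro!: sum.neutral)
qed

theorem theorem3p4:
  fixes k d :: nat and b :: expvec
  assumes "k \<ge> 1" and "b \<in> expvecs k d"
  shows "zero_row k d b \<longleftrightarrow> spike k b"
proof
  assume spike: "spike k b"
  show "zero_row k d b"
    unfolding zero_row_def
  proof (clarify, subst hit_matrix_eq_0_iff, assumption, intro ballI impI)
    fix t g c
    assume c: "c \<in> expvecs k (2 ^ t)" and b: "b = g + c"
    \<comment> \<open>The total increment \<open>2\<^sup>t\<close> is positive, so some exponent really is raised.\<close>
    have "(\<Sum>i<k. Poly_Mapping.lookup c i) \<noteq> 0"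
      using c by (simp add: expvecs_def)
    then obtain i where i: "i < k" "0 < Poly_Mapping.lookup c i"
      by (metis gr0I lessThan_iff sum.neutral)
    obtain m where "Poly_Mapping.lookup b i = 2 ^ m - 1"
      using spike i by (auto simp: spike_def)
    then have m: "Poly_Mapping.lookup g i + Poly_Mapping.lookup c i = 2 ^ m - 1"
      by (simp add: b lookup_add)
    then have "Poly_Mapping.lookup g i = 2 ^ m - 1 - Poly_Mapping.lookup c i"
      by simp
    then show "\<exists>i<k. even (Poly_Mapping.lookup g i choose Poly_Mapping.lookup c i)"
      using even_choose_complement[OF i(2), of m] m i(1) by auto
  qed
next
  assume zero: "zero_row k d b"
  show "spike k b"
  proof (rule ccontr)
    assume "\<not> spike k b"
    then obtain i where i: "i < k" and "\<nexists>m. Poly_Mapping.lookup b i = 2 ^ m - 1"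
      by (auto simp: spike_def)
    then obtain t where t: "2 ^ t \<le> Poly_Mapping.lookup b i"
        "odd ((Poly_Mapping.lookup b i - 2 ^ t) choose 2 ^ t)"
      using odd_choose_pow2 by blast
    define c :: expvec where "c = Poly_Mapping.single i (2 ^ t)"
    define g where "g = b - c"
    have b: "b = g + c"
      using t(1) by (intro poly_mapping_eqI)
        (auto simp: g_def c_def lookup_add lookup_minus lookup_single when_def)
    have c: "c \<in> expvecs k (2 ^ t)"
      using i by (simp add: expvecs_def c_def lookup_single when_def)
    have "(\<Sum>j<k. Poly_Mapping.lookup g j) + 2 ^ t = d"
      using assms(2) c unfolding b by (simp add: expvecs_def lookup_add sum.distrib)
    moreover have "Poly_Mapping.keys g \<subseteq> {..<k}"
      using assms(2) by (force simp: expvecs_def g_def subset_iff in_keys_iff lookup_minus)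
    ultimately have col: "(t, g) \<in> hit_columns k d"
      by (auto simp: hit_columns_def expvecs_def)
    have "odd (Poly_Mapping.lookup g j choose Poly_Mapping.lookup c j)" for j
      using t(2) by (auto simp: g_def c_def lookup_minus lookup_single when_def)
    then have "hit_matrix k d b (t, g) \<noteq> 0"
      using hit_matrix_eq_0_iff[OF col] b c by blast
    with zero col show False
      by (auto simp: zero_row_def)
  qed
qed

end
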